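(* For $n\ge1$ write $P_n(X)=\sum_{i\ge1}a_{i,n}H_i(X)$. Then $$\forall n\ge1,\quad a_{n,n}=n!,$$ $$\forall n\ge2,\quad a_{n-1,n}=n!\left(\frac{n+1}{2}-\zeta_n(1)\right),$$ $$\forall n\ge3,\quad a_{n-2,n}=n!\left(\zeta_n(1,1)-\frac n2\zeta_n(1)+\frac{(3n-2)(n^2+n+6)}{24n}\right).$$ Moreover, the sequence $(a_{n-1,n})_{n\ge2}$ is Entry A31853 in the OEIS (On-Line Encyclopedia of Integer Sequences).
   Context: For $n,k_1,\ldots,k_p\ge1$, $\zeta_n(k_1,\ldots,k_p)=\sum_{1\le n_1<\ldots<n_p\le n}\frac{1}{n_1^{k_1}\cdots n_p^{k_p}}$. $H_i(X)=X(X-1)\cdots(X-i+1)/i!$ is the $i$-th Hilbert polynomial ($H_0=1$), over a field $\mathbb{K}$ of characteristic zero. The sequence $(P_n)_{n\ge0}$ of polynomials in $\mathbb{K}[X]$ is characterized by $P_0(X)=1$ and, for all $k\ge1$, $P_k(0)=0$ and $P_k(X+1)=P_k(X)+\sum_{i=1}^kP_{i-1}(X)P_{k-i}(X)$. Equivalently, for $n,N\ge1$, $P_n(N)$ is the number of maps $c:\{1,\ldots,n\}\to\{1,\ldots,N\}$ such that whenever $p<r$ and $c(p)=c(r)$ there is $q$ with $p<q<r$ and $c(q)<c(p)$; thus $a_{i,n}$ is the number of such maps that are surjective onto $\{1,\ldots,i\}$. (For $n\ge1$, $P_n$ is the value, on the noncrossing partition $\{\{1\},\ldots,\{n\}\}$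 into singletons, of the unique double bialgebra morphism from the double bialgebra of noncrossing partitions to $\mathbb{K}[X]$.) *)

theory Defs
  imports Complex_Main "HOL-Computational_Algebra.Polynomial"
begin

section \<open>Truncated multiple zeta values\<close>

definition trunc_mzv :: "nat \<Rightarrow> nat list \<Rightarrow> 'a::field_char_0"
  where "trunc_mzv n ks =
    (\<Sum>ns | length ns = length ks \<and> sorted_wrt (<) ns \<and> set ns \<subseteq> {1..n}.
       \<Prod>j<length ks. 1 / of_nat (ns ! j) ^ (ks ! j))"


section \<open>Hilbert polynomials\<close>

definition hilbert_poly :: "nat \<Rightarrow> 'a::field_char_0 poly"
  where "hilbert_poly i = smult (1 / fact i) (\<Prod>j<i. [:- of_nat j, 1:])"

lemma poly_hilbert_poly: "poly (hilbert_poly i) x = x gchoose i"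
  by (simp add: hilbert_poly_def poly_prod gbinomial_prod_rev lessThan_atLeast0)

lemma poly_eqI_all:
  fixes p q :: "'a::field_char_0 poly"
  assumes "\<And>x. poly p x = poly q x"
  shows "p = q"
  using assms poly_eq_poly_eq_iff by blast

lemma hilbert_poly_shift:
  "pcompose (hilbert_poly (Suc i)) [:1, 1:] = hilbert_poly (Suc i) + hilbert_poly i"
  by (rule poly_eqI_all) (simp add: poly_pcompose poly_hilbert_poly add.commute[of 1]
      gbinomial_Suc_Suc)

lemma degree_hilbert_poly: "degree (hilbert_poly i :: 'a::field_char_0 poly) = i"
proof -
  have "degree (\<Prod>j<i. [:- of_nat j, 1:] :: 'a poly) = (\<Sum>j<i. degree ([:- of_nat j, 1:] :: 'a poly))"
    by (rule degree_prod_eq_sum_degree) auto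
  then show ?thesis by (simp add: hilbert_poly_def)
qed

lemma hilbert_expansion_exists:
  fixes p :: "'a::field_char_0 poly"
  shows "\<exists>c. p = (\<Sum>i\<le>degree p. smult (c i) (hilbert_poly i))"
proof -
  have "\<exists>c. p = (\<Sum>i<d. smult (c i) (hilbert_poly i))" if "\<forall>i\<ge>d. coeff p i = 0" for d and p :: "'a poly"
    using that
  proof (induction d arbitrary: p)
    case 0
    then show ?case by (auto intro: poly_eqI)
  next
    case (Suc d)
    let ?h = "hilbert_poly d :: 'a poly"
    have h0: "?h \<noteq> 0"
      by (auto simp: hilbert_poly_def)
    have hd: "coeff ?h d \<noteq> 0"
      using h0 degree_hilbert_poly[where 'a='a, of d] leading_coeff_neq_0[of ?h] by simp
    define b where "b = coeff p d / coeff ?h d"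
    have "\<forall>i\<ge>d. coeff (p - smult b ?h) i = 0"
    proof (intro allI impI)
      fix i assume "d \<le> i"
      show "coeff (p - smult b ?h) i = 0"
      proof (cases "i = d")
        case True
        then show ?thesis using hd by (simp add: b_def)
      next
        case False
        then have "i > d" using \<open>d \<le> i\<close> by simp
        then show ?thesis
          using Suc.prems by (simp add: coeff_eq_0 degree_hilbert_poly)
      qed
    qed
    from Suc.IH[OF this] obtain c
      where c: "p - smult b ?h = (\<Sum>i<d. smult (c i) (hilbert_poly i))" by blast
    have "(\<Sum>i<Suc d. smult ((c(d := b)) i) (hilbert_poly i)) = p"
      using c by (simp add: algebra_simps)
    then show ?case by metis
  qed
  from this[where p = p and d = "Suc (degree p)"] show ?thesis
    by (simp add: lessThan_Suc_atMost coeff_eq_0)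
qed


section \<open>The polynomial sequence\<close>

definition nc_poly_seq :: "(nat \<Rightarrow> 'a::field_char_0 poly) \<Rightarrow> bool"
  where "nc_poly_seq P \<longleftrightarrow> P 0 = 1 \<and>
    (\<forall>k\<ge>1. poly (P k) 0 = 0 \<and>
       pcompose (P k) [:1, 1:] = P k + (\<Sum>i=1..k. P (i - 1) * P (k - i)))"

text \<open>
  For \<open>n \<ge> 1\<close>, \<open>nc_poly n\<close> is also the value of the double bialgebra morphism from noncrossing
  partitions to polynomials on the partition of \<open>{1..n}\<close> into singletons. The definite description
  is justified by \<open>nc_poly_seq_nc_poly\<close> and \<open>nc_poly_seq_unique\<close> below.
\<close>

definition nc_poly :: "nat \<Rightarrow> 'a::field_char_0 poly"
  where "nc_poly = (THE P. nc_poly_seq P)"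

lemma antidifference_unique:
  fixes p q :: "'a::field_char_0 poly"
  assumes "pcompose p [:1, 1:] - p = pcompose q [:1, 1:] - q" and "poly p 0 = poly q 0"
  shows "p = q"
proof -
  let ?r = "p - q"
  have step: "poly ?r (x + 1) = poly ?r x" for x
    using arg_cong[OF assms(1), of "\<lambda>u. poly u x"]
    by (simp add: poly_pcompose algebra_simps)
  have "poly ?r (of_nat n) = 0" for n
    using assms(2) step[of "of_nat m" for m]
    by (induction n) (simp_all add: add.commute)
  then have "range (of_nat :: nat \<Rightarrow> 'a) \<subseteq> {x. poly ?r x = 0}" by auto
  moreover have "infinite (range (of_nat :: nat \<Rightarrow> 'a))"
    by (simp add: range_inj_infinite inj_of_nat)
  ultimately have "infinite {x. poly ?r x = 0}" using finite_subset by blast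
  then show ?thesis using poly_roots_finite[of ?r] by auto
qed

lemma antidifference_exists:
  fixes q :: "'a::field_char_0 poly"
  shows "\<exists>p. poly p 0 = 0 \<and> pcompose p [:1, 1:] = p + q"
proof -
  obtain c where c: "q = (\<Sum>i\<le>degree q. smult (c i) (hilbert_poly i))"
    using hilbert_expansion_exists by blast
  let ?p = "\<Sum>i\<le>degree q. smult (c i) (hilbert_poly (Suc i))"
  have "poly ?p 0 = 0" by (simp add: poly_sum poly_hilbert_poly)
  moreover have "pcompose ?p [:1, 1:] = ?p + q"
  proof -
    have "pcompose ?p [:1, 1:] = ?p + (\<Sum>i\<le>degree q. smult (c i) (hilbert_poly i))"
      by (simp add: pcompose_sum pcompose_smult hilbert_poly_shift smult_add_right sum.distrib)
    then show ?thesis by (simp only: c[symmetric])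
  qed
  ultimately show ?thesis by blast
qed

lemma nc_poly_seq_unique:
  assumes P: "nc_poly_seq P" and Q: "nc_poly_seq Q"
  shows "P = Q"
proof
  fix k
  show "P k = Q k"
  proof (induction k rule: less_induct)
    case (less k)
    show ?case
    proof (cases "k = 0")
      case True
      then show ?thesis using P Q by (simp add: nc_poly_seq_def)
    next
      case False
      have "(\<Sum>i=1..k. P (i - 1) * P (k - i)) = (\<Sum>i=1..k. Q (i - 1) * Q (k - i))"
        by (rule sum.cong) (use less in auto)
      moreover have "poly (P k) 0 = 0"
        "pcompose (P k) [:1, 1:] = P k + (\<Sum>i=1..k. P (i - 1) * P (k - i))"
        using P False unfolding nc_poly_seq_def by (meson less_one not_le)+
      moreover have "poly (Q k) 0 = 0"
        "pcompose (Q k) [:1, 1:] = Q k + (\<Sum>i=1..k. Q (i - 1) * Q (k - i))"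
        using Q False unfolding nc_poly_seq_def by (meson less_one not_le)+
      ultimately show ?thesis
        by - (rule antidifference_unique, simp_all only: add_diff_cancel_left')
    qed
  qed
qed

lemma nc_poly_seq_exists: "\<exists>P :: nat \<Rightarrow> 'a::field_char_0 poly. nc_poly_seq P"
proof -
  define \<Sigma> :: "'a poly \<Rightarrow> 'a poly"
    where "\<Sigma> q = (SOME p. poly p 0 = 0 \<and> pcompose p [:1, 1:] = p + q)" for q
  have \<Sigma>: "poly (\<Sigma> q) 0 = 0 \<and> pcompose (\<Sigma> q) [:1, 1:] = \<Sigma> q + q" for q
    unfolding \<Sigma>_def by (rule someI_ex[OF antidifference_exists])
  define F where "F f k = (if k = 0 then 1 else \<Sigma> (\<Sum>i=1..k. f (i - 1) * f (k - i)))"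
    for f :: "nat \<Rightarrow> 'a poly" and k
  define P where "P = wfrec less_than F"
  have adm: "adm_wf less_than F"
    unfolding adm_wf_def
  proof (intro allI impI)
    fix f g :: "nat \<Rightarrow> 'a poly" and x :: nat
    assume fg: "\<forall>z. (z, x) \<in> less_than \<longrightarrow> f z = g z"
    have "(\<Sum>i=1..x. f (i - 1) * f (x - i)) = (\<Sum>i=1..x. g (i - 1) * g (x - i))"
      by (rule sum.cong) (use fg in auto)
    then show "F f x = F g x" by (simp add: F_def)
  qed
  have P: "P k = F P k" for k
    unfolding P_def using wfrec_fixpoint[OF wf_less_than adm] by metis
  have "nc_poly_seq P"
    unfolding nc_poly_seq_def
  proof (intro conjI allI impI)
    show "P 0 = 1" by (subst P) (simp add: F_def)
    fix k :: nat assume k: "1 \<le> k"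
    have Pk: "P k = \<Sigma> (\<Sum>i=1..k. P (i - 1) * P (k - i))"
      using k by (subst P) (simp add: F_def)
    show "poly (P k) 0 = 0"
      using \<Sigma> Pk by metis
    show "pcompose (P k) [:1, 1:] = P k + (\<Sum>i=1..k. P (i - 1) * P (k - i))"
      using \<Sigma> Pk by metis
  qed
  then show ?thesis by blast
qed

lemma nc_poly_seq_nc_poly: "nc_poly_seq nc_poly"
  unfolding nc_poly_def
  by (rule theI'[of nc_poly_seq]) (use nc_poly_seq_exists nc_poly_seq_unique in blast)


section \<open>Coefficients in the basis of Hilbert polynomials\<close>

text \<open>
  The sum over all \<open>i \<ge> 1\<close> is rendered as the finite sum over the support of the coefficients,
  whose finiteness is part of the predicate; the value \<open>a 0\<close> is irrelevant.
\<close>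

definition hilbert_expansion :: "(nat \<Rightarrow> 'a::field_char_0) \<Rightarrow> 'a poly \<Rightarrow> bool"
  where "hilbert_expansion a p \<longleftrightarrow> finite {i. 1 \<le> i \<and> a i \<noteq> 0} \<and>
    p = (\<Sum>i | 1 \<le> i \<and> a i \<noteq> 0. smult (a i) (hilbert_poly i))"

lemma nc_poly_hilbert_expansion_exists:
  assumes "n \<ge> 1"
  shows "\<exists>a. hilbert_expansion a (nc_poly n :: 'a::field_char_0 poly)"
proof -
  let ?p = "nc_poly n :: 'a poly"
  obtain c where c: "?p = (\<Sum>i\<le>degree ?p. smult (c i) (hilbert_poly i))"
    using hilbert_expansion_exists by blast
  have "poly ?p 0 = 0"
    using nc_poly_seq_nc_poly[where 'a='a] assms by (simp add: nc_poly_seq_def)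
  moreover have "poly (\<Sum>i\<le>degree ?p. smult (c i) (hilbert_poly i)) 0 = c 0"
  proof -
    have "poly (\<Sum>i\<le>degree ?p. smult (c i) (hilbert_poly i)) 0
        = (\<Sum>i\<le>degree ?p. c i * (0 gchoose i))"
      by (simp add: poly_sum poly_hilbert_poly)
    also have "\<dots> = (\<Sum>i\<le>degree ?p. if i = 0 then c 0 else 0)"
      by (rule sum.cong) (auto simp: gr0_conv_Suc)
    finally show ?thesis by simp
  qed
  ultimately have c0: "c 0 = 0" using arg_cong[OF c, of "\<lambda>p. poly p 0"] by (simp only:)
  define a where "a i = (if i \<le> degree ?p then c i else 0)" for i
  have sub: "{i. 1 \<le> i \<and> a i \<noteq> 0} \<subseteq> {..degree ?p}"
    by (auto simp: a_def split: if_splits)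
  then have fin: "finite {i. 1 \<le> i \<and> a i \<noteq> 0}" using finite_subset by blast
  have "(\<Sum>i | 1 \<le> i \<and> a i \<noteq> 0. smult (a i) (hilbert_poly i))
      = (\<Sum>i\<le>degree ?p. smult (a i) (hilbert_poly i))"
  proof (rule sum.mono_neutral_left)
    show "\<forall>i\<in>{..degree ?p} - {i. 1 \<le> i \<and> a i \<noteq> 0}. smult (a i) (hilbert_poly i) = 0"
    proof
      fix i assume "i \<in> {..degree ?p} - {i. 1 \<le> i \<and> a i \<noteq> 0}"
      then have "a i = 0" using c0 by (cases i) (auto simp: a_def)
      then show "smult (a i) (hilbert_poly i) = 0" by simp
    qed
  qed (use sub in auto)
  also have "\<dots> = (\<Sum>i\<le>degree ?p. smult (c i) (hilbert_poly i))"
    by (rule sum.cong) (auto simp: a_def)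
  also have "\<dots> = ?p" by (rule c[symmetric])
  finally show ?thesis
    using fin by (auto simp: hilbert_expansion_def)
qed

end

theory Submission
  imports Defs "HOL-Computational_Algebra.Formal_Power_Series"
begin

text \<open>
  The defining recursion is quadratic, but it hides a linear one. With
  \<open>U\<^sub>N = (\<Sum>n. P\<^sub>n(N) t\<^sup>n\<^sup>+\<^sup>1)\<close>, it reads \<open>U\<^sub>0 = t\<close> and \<open>U\<^sub>N\<^sub>+\<^sub>1 = U\<^sub>N + U\<^sub>N\<^sup>2\<close>, so \<open>U\<^sub>N\<close> is the
  \<open>N\<close>-fold iterate of \<open>f(t) = t + t\<^sup>2\<close>, obtained by composing with \<open>f\<close> on the left. Composing on the
  right instead (\<open>nc_genfun_Suc_compose\<close>) gives \<open>U\<^sub>N\<^sub>+\<^sub>1(t) = U\<^sub>N(t + t\<^sup>2)\<close>, that is,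
  \<open>P\<^sub>n(N + 1) = (\<Sum>m\<le>n. P\<^sub>m(N) (m + 1 choose n - m))\<close>, which is linear in the sequence of
  polynomials. Both have a combinatorial reading: \<open>P\<^sub>n(N)\<close> counts the words of length \<open>n\<close> in the
  colours \<open>1, \<dots>, N\<close> in which two equal colours are always separated by a smaller one. The quadratic
  recursion removes the smallest colour, which occurs at most once and cuts the word in two; the linear one removes the largest colour, whose
  \<open>n - m\<close> occurrences sit in distinct gaps among the \<open>m + 1\<close> gaps of the word of the \<open>m\<close> remaining
  letters.

  In the basis of Hilbert polynomials, passing to the difference \<open>P\<^sub>n(X + 1) - P\<^sub>n(X)\<close> shifts the
  index \<open>i\<close> of \<open>a\<^sub>i\<^sub>,\<^sub>n\<close> by one, so the coefficients satisfy
  \<open>a\<^sub>i\<^sub>+\<^sub>1\<^sub>,\<^sub>n = (\<Sum>m<n. a\<^sub>i\<^sub>,\<^sub>m (m + 1 choose n - m))\<close> with \<open>a\<^sub>0\<^sub>,\<^sub>n = \<delta>\<^sub>n\<^sub>,\<^sub>0\<close>. This array is \<open>nc_surj\<close>, and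
  \<open>hilbert_expansion_nc_poly\<close> identifies it. It vanishes for \<open>n < i\<close>, so the \<open>d\<close>-th diagonal
  \<open>n = i + d\<close> is determined by a first order recursion in \<open>i\<close> whose inhomogeneous part involves only
  the earlier diagonals. Dividing by \<open>n!\<close> turns each recursion into a sum: the increments are
  \<open>0\<close> for \<open>d = 0\<close>, \<open>1/2 - 1/n\<close> for \<open>d = 1\<close> (whence \<open>\<zeta>\<^sub>n(1)\<close>), and for \<open>d = 2\<close> a rational function
  of \<open>n\<close> plus \<open>(1/n - 1/2) \<zeta>\<^sub>n\<^sub>-\<^sub>2(1)\<close>, whose summation produces \<open>\<zeta>\<^sub>n(1,1)\<close> and \<open>n/2 \<zeta>\<^sub>n(1)\<close>.
\<close>

section \<open>Truncated multiple zeta values\<close>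

lemma trunc_mzv_Nil: "trunc_mzv n [] = 1"
proof -
  have "{ns. length ns = length ([]::nat list) \<and> sorted_wrt (<) ns \<and> set ns \<subseteq> {1..n}} = {[]}"
    by auto
  then show ?thesis by (simp add: trunc_mzv_def)
qed

lemma trunc_mzv_0: "ks \<noteq> [] \<Longrightarrow> trunc_mzv 0 ks = 0"
  by (auto simp: trunc_mzv_def intro!: sum.neutral)

text \<open>
  A strictly increasing list of indices up to \<open>n + 1\<close> either stays below \<open>n + 1\<close>, or ends with it.
\<close>

lemma trunc_mzv_Suc_snoc:
  "trunc_mzv (Suc n) (ks @ [k])
    = trunc_mzv n (ks @ [k]) + trunc_mzv n ks / (of_nat (Suc n) ^ k :: 'a::field_char_0)"
proof -
  define S where "S l m = {ns. length ns = l \<and> sorted_wrt (<) ns \<and> set ns \<subseteq> {1..m}}" for l m :: nat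
  define L where "L = length ks"
  let ?g = "\<lambda>ks ns. \<Prod>j<length ks. 1 / (of_nat (ns ! j) ^ (ks ! j) :: 'a)"
  have fin: "finite (S l m)" for l m
    by (rule finite_subset[OF _ finite_lists_length_eq[of "{1..m}" l]]) (auto simp: S_def)
  have split: "S (Suc L) (Suc n) = S (Suc L) n \<union> (\<lambda>ms. ms @ [Suc n]) ` S L n"
  proof (intro set_eqI iffI)
    fix ns assume ns: "ns \<in> S (Suc L) (Suc n)"
    then obtain ms x where e: "ns = ms @ [x]"
      by (cases ns rule: rev_cases) (auto simp: S_def)
    have len: "length ms = L" and srt: "sorted_wrt (<) ms" and x: "1 \<le> x" "x \<le> Suc n"
      and ms: "\<And>y. y \<in> set ms \<Longrightarrow> 1 \<le> y \<and> y < x"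
      using ns by (auto simp: e S_def sorted_wrt_append)
    show "ns \<in> S (Suc L) n \<union> (\<lambda>ms. ms @ [Suc n]) ` S L n"
    proof (cases "x = Suc n")
      case True
      have "ms \<in> S L n"
        using len srt ms True by (auto simp: S_def less_Suc_eq_le)
      then show ?thesis using e True by blast
    next
      case False
      then have "x \<le> n" using x by simp
      moreover have "1 \<le> y \<and> y \<le> n" if "y \<in> set ms" for y
        using ms[OF that] \<open>x \<le> n\<close> by simp
      ultimately have "ns \<in> S (Suc L) n"
        using len srt ms x by (auto simp: e S_def sorted_wrt_append)
      then show ?thesis by blast
    qed
  next
    fix ns assume "ns \<in> S (Suc L) n \<union> (\<lambda>ms. ms @ [Suc n]) ` S L n"
    then show "ns \<in> S (Suc L) (Suc n)"
    proof
      assume "ns \<in> S (Suc L) n"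
      then show ?thesis by (auto simp: S_def)
    next
      assume "ns \<in> (\<lambda>ms. ms @ [Suc n]) ` S L n"
      then obtain ms where "ms \<in> S L n" "ns = ms @ [Suc n]" by blast
      then show ?thesis by (auto simp: S_def sorted_wrt_append)
    qed
  qed
  have disj: "S (Suc L) n \<inter> (\<lambda>ms. ms @ [Suc n]) ` S L n = {}"
    by (auto simp: S_def)
  have last: "?g (ks @ [k]) (ms @ [Suc n]) = ?g ks ms / of_nat (Suc n) ^ k" if "ms \<in> S L n" for ms
    using that by (simp add: S_def L_def nth_append)
  have "trunc_mzv (Suc n) (ks @ [k]) = (\<Sum>ns\<in>S (Suc L) (Suc n). ?g (ks @ [k]) ns)"
    by (simp add: trunc_mzv_def S_def L_def)
  also have "\<dots> = (\<Sum>ns\<in>S (Suc L) n. ?g (ks @ [k]) ns)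
      + (\<Sum>ns\<in>(\<lambda>ms. ms @ [Suc n]) ` S L n. ?g (ks @ [k]) ns)"
    unfolding split by (rule sum.union_disjoint) (use fin disj in auto)
  also have "(\<Sum>ns\<in>(\<lambda>ms. ms @ [Suc n]) ` S L n. ?g (ks @ [k]) ns)
      = (\<Sum>ms\<in>S L n. ?g (ks @ [k]) (ms @ [Suc n]))"
    by (rule sum.reindex_cong[OF _ refl refl]) (auto simp: inj_on_def)
  also have "\<dots> = (\<Sum>ms\<in>S L n. ?g ks ms / of_nat (Suc n) ^ k)"
    by (rule sum.cong[OF refl last])
  also have "\<dots> = trunc_mzv n ks / of_nat (Suc n) ^ k"
    by (simp add: trunc_mzv_def S_def L_def sum_divide_distrib)
  also have "(\<Sum>ns\<in>S (Suc L) n. ?g (ks @ [k]) ns) = trunc_mzv n (ks @ [k])"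
    by (simp add: trunc_mzv_def S_def L_def)
  finally show ?thesis .
qed

lemmas trunc_mzv_1_Suc = trunc_mzv_Suc_snoc[of _ "[]" 1, simplified trunc_mzv_Nil, simplified]

lemma trunc_mzv_1_numeral:
  "trunc_mzv (numeral k) [Suc 0]
    = trunc_mzv (pred_numeral k) [Suc 0] + 1 / (numeral k :: 'a::field_char_0)"
  using trunc_mzv_1_Suc[of "pred_numeral k", where 'a='a]
  by (simp flip: numeral_eq_Suc of_nat_Suc)

lemmas trunc_mzv_11_Suc = trunc_mzv_Suc_snoc[of _ "[1]" 1, simplified]

section \<open>Uniqueness of Hilbert expansions\<close>

text \<open>
  Evaluation at \<open>0, 1, 2, \<dots>\<close> is a unitriangular system, because the \<open>i\<close>-th Hilbert polynomial
  vanishes at every natural number below \<open>i\<close> and takes the value \<open>1\<close> at \<open>i\<close>.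
\<close>

lemma hilbert_combination_eq_0D:
  fixes d :: "nat \<Rightarrow> 'a::field_char_0"
  assumes 0: "(\<Sum>i\<in>I. smult (d i) (hilbert_poly i)) = 0" and "finite I" "i \<in> I"
  shows "d i = 0"
  using \<open>i \<in> I\<close>
proof (induction i rule: less_induct)
  case (less i)
  have "0 = (\<Sum>j\<in>I. d j * of_nat (i choose j))"
    using arg_cong[OF 0, of "\<lambda>p. poly p (of_nat i)"]
    by (simp add: poly_sum poly_hilbert_poly binomial_gbinomial)
  also have "\<dots> = (\<Sum>j\<in>I. if j = i then d i else 0)"
  proof (rule sum.cong[OF refl])
    fix j assume "j \<in> I"
    then show "d j * of_nat (i choose j) = (if j = i then d i else 0)"
      using less.IH[of j] by (cases j i rule: linorder_cases) auto
  qed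
  finally show ?case using \<open>finite I\<close> less.prems by simp
qed

lemma hilbert_expansion_superset:
  assumes "finite I" "\<And>i. i \<in> I \<Longrightarrow> 1 \<le> i" "\<And>i. 1 \<le> i \<Longrightarrow> a i \<noteq> 0 \<Longrightarrow> i \<in> I"
  shows "hilbert_expansion a p \<longleftrightarrow> p = (\<Sum>i\<in>I. smult (a i) (hilbert_poly i))"
proof -
  have sub: "{i. 1 \<le> i \<and> a i \<noteq> 0} \<subseteq> I" using assms by auto
  moreover have "(\<Sum>i | 1 \<le> i \<and> a i \<noteq> 0. smult (a i) (hilbert_poly i))
      = (\<Sum>i\<in>I. smult (a i) (hilbert_poly i))"
    by (rule sum.mono_neutral_left) (use assms sub in auto)
  ultimately show ?thesis
    using finite_subset[OF sub] assms by (simp add: hilbert_expansion_def)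
qed

lemma hilbert_expansion_unique:
  assumes a: "hilbert_expansion a p" and b: "hilbert_expansion b p" and i: "1 \<le> i"
  shows "a i = b i"
proof -
  define I where "I = insert i ({i. 1 \<le> i \<and> a i \<noteq> 0} \<union> {i. 1 \<le> i \<and> b i \<noteq> 0})"
  have fin: "finite I" using a b by (simp add: I_def hilbert_expansion_def)
  have "p = (\<Sum>i\<in>I. smult (a i) (hilbert_poly i))"
    using hilbert_expansion_superset[of I a p] a fin i by (auto simp: I_def)
  moreover have "p = (\<Sum>i\<in>I. smult (b i) (hilbert_poly i))"
    using hilbert_expansion_superset[of I b p] b fin i by (auto simp: I_def)
  ultimately have "(\<Sum>i\<in>I. smult (a i - b i) (hilbert_poly i)) = 0"
    by (simp add: smult_diff_left sum_subtractf)
  from hilbert_combination_eq_0D[OF this fin, of i] show ?thesis by (simp add: I_def)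
qed

section \<open>The linear recursion for the polynomials\<close>

unbundle fps_syntax

definition nc_genfun :: "nat \<Rightarrow> 'a::field_char_0 fps"
  where "nc_genfun N = fps_X * Abs_fps (\<lambda>n. poly (nc_poly n) (of_nat N))"

lemma nc_genfun_nth_0: "nc_genfun N $ 0 = 0"
  by (simp add: nc_genfun_def)

lemma nc_genfun_nth_Suc: "nc_genfun N $ Suc n = poly (nc_poly n) (of_nat N)"
  by (simp add: nc_genfun_def)

lemma nc_poly_0: "nc_poly 0 = 1"
  using nc_poly_seq_nc_poly by (auto simp: nc_poly_seq_def)

lemma poly_nc_poly_at_0: "poly (nc_poly n) (0::'a::field_char_0) = (if n = 0 then 1 else 0)"
proof (cases "n = 0")
  case False
  then have "n \<ge> 1" by simp
  then have "poly (nc_poly n :: 'a poly) 0 = 0"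
    using nc_poly_seq_nc_poly[where 'a='a] unfolding nc_poly_seq_def by blast
  then show ?thesis using False by simp
qed (simp add: nc_poly_0)

lemma poly_nc_poly_add_1:
  fixes x :: "'a::field_char_0"
  assumes "n \<ge> 1"
  shows "poly (nc_poly n) (x + 1) =
    poly (nc_poly n) x + (\<Sum>i=1..n. poly (nc_poly (i - 1)) x * poly (nc_poly (n - i)) x)"
proof -
  have "pcompose (nc_poly n) [:1, 1::'a:] = nc_poly n + (\<Sum>i=1..n. nc_poly (i - 1) * nc_poly (n - i))"
    using nc_poly_seq_nc_poly assms unfolding nc_poly_seq_def by blast
  from arg_cong[OF this, of "\<lambda>p. poly p x"] show ?thesis
    by (simp add: poly_pcompose poly_sum add.commute)
qed

lemma nc_genfun_0: "nc_genfun 0 = fps_X"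
  by (rule fps_ext) (auto simp: nc_genfun_def poly_nc_poly_at_0)

lemma nc_genfun_Suc: "nc_genfun (Suc N) = nc_genfun N + nc_genfun N ^ 2"
proof (rule fps_ext)
  fix k
  show "nc_genfun (Suc N) $ k = (nc_genfun N + nc_genfun N ^ 2 :: 'a fps) $ k"
  proof (cases k)
    case 0
    then show ?thesis by (simp add: nc_genfun_nth_0)
  next
    case (Suc n)
    define F :: "'a fps" where "F = Abs_fps (\<lambda>n. poly (nc_poly n) (of_nat N))"
    have F: "nc_genfun N = fps_X * F" by (simp add: F_def nc_genfun_def)
    have sq: "(nc_genfun N ^ 2) $ Suc n = (if n = 0 then 0 else (F * F) $ (n - 1))"
      unfolding F by (simp add: power2_eq_square mult.assoc mult.left_commute[of F])
    show ?thesis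
    proof (cases n)
      case 0
      then show ?thesis
        using sq Suc by (simp add: nc_genfun_nth_Suc nc_poly_0)
    next
      case (Suc m)
      have "(F * F) $ m = (\<Sum>i=1..n. poly (nc_poly (i - 1)) (of_nat N) * poly (nc_poly (n - i)) (of_nat N))"
        unfolding fps_mult_nth F_def
        by (rule sum.reindex_bij_witness[of _ "\<lambda>i. i - 1" Suc]) (auto simp: Suc)
      then show ?thesis
        using sq \<open>k = Suc n\<close> poly_nc_poly_add_1[of n "of_nat N :: 'a"] Suc
        by (simp add: nc_genfun_nth_Suc add.commute)
    qed
  qed
qed

text \<open>
  The series are the iterates of \<open>t + t\<^sup>2\<close>, and an iterate commutes with the function itself.
\<close>

lemma nc_genfun_Suc_compose:
  "nc_genfun (Suc N) = fps_compose (nc_genfun N) (fps_X + fps_X ^ 2 :: 'a::field_char_0 fps)"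
proof (induction N)
  case 0
  show ?case by (simp add: nc_genfun_Suc nc_genfun_0)
next
  case (Suc N)
  have "(nc_genfun (Suc (Suc N)) :: 'a fps) = nc_genfun (Suc N) + nc_genfun (Suc N) ^ 2"
    by (rule nc_genfun_Suc)
  also have "\<dots> = fps_compose (nc_genfun N + nc_genfun N ^ 2) (fps_X + fps_X ^ 2)"
    unfolding fps_compose_add_distrib Suc.IH
    by (subst fps_compose_power) simp_all
  finally show ?case by (simp only: nc_genfun_Suc)
qed

lemma fps_X_plus_X2_power_nth:
  "((fps_X + fps_X ^ 2 :: 'a::field_char_0 fps) ^ m) $ n
    = (if n < m then 0 else of_nat (m choose (n - m)))"
proof -
  have "(fps_X + fps_X ^ 2 :: 'a fps) = fps_X * (1 + fps_X)"
    by (simp add: algebra_simps power2_eq_square)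
  then have "(fps_X + fps_X ^ 2 :: 'a fps) ^ m = fps_X ^ m * (1 + fps_X) ^ m"
    by (simp add: power_mult_distrib)
  also have "(1 + fps_X :: 'a fps) ^ m = fps_binomial (of_nat m)"
    by (simp add: fps_binomial_of_nat)
  finally show ?thesis
    by (simp add: fps_X_power_mult_nth binomial_gbinomial)
qed

lemma poly_nc_poly_of_nat_Suc:
  "poly (nc_poly n) (of_nat (Suc N) :: 'a::field_char_0)
    = (\<Sum>m\<le>n. poly (nc_poly m) (of_nat N) * of_nat (Suc m choose (n - m)))"
proof -
  have "poly (nc_poly n) (of_nat (Suc N) :: 'a)
      = (\<Sum>i=0..Suc n. nc_genfun N $ i * ((fps_X + fps_X ^ 2) ^ i) $ Suc n)"
    by (simp only: nc_genfun_nth_Suc[symmetric] nc_genfun_Suc_compose fps_compose_nth)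
  also have "\<dots> = (\<Sum>m=0..n. nc_genfun N $ Suc m * ((fps_X + fps_X ^ 2) ^ Suc m) $ Suc n)"
    unfolding sum.atLeast0_atMost_Suc_shift by (simp add: nc_genfun_nth_0)
  also have "\<dots> = (\<Sum>m\<le>n. poly (nc_poly m) (of_nat N) * of_nat (Suc m choose (n - m)))"
    unfolding fps_X_plus_X2_power_nth nc_genfun_nth_Suc
    by (rule sum.cong) (auto simp: atLeast0AtMost)
  finally show ?thesis .
qed

section \<open>The Hilbert coefficients\<close>

text \<open>
  The number of maps from \<open>{1..n}\<close> onto \<open>{1..i}\<close> in which two equal values are always separated by a
  smaller one, computed by removing the largest value \<open>i\<close>.
\<close>

fun nc_surj :: "nat \<Rightarrow> nat \<Rightarrow> nat"
  where
    "nc_surj 0 n = (if n = 0 then 1 else 0)"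
  | "nc_surj (Suc i) n = (\<Sum>m<n. nc_surj i m * (Suc m choose (n - m)))"

lemma nc_surj_eq_0: "n < i \<Longrightarrow> nc_surj i n = 0"
  by (induction i arbitrary: n) auto

text \<open>
  Both sides satisfy the same linear recursion in \<open>N\<close>: on the right, Pascal's rule for
  \<open>N + 1 choose i\<close> produces the term \<open>m = n\<close> together with the terms \<open>m < n\<close> of the recursion for
  \<open>nc_surj\<close>. The upper bound \<open>K\<close> is arbitrary so that one range serves all the indices \<open>m \<le> n\<close>.
\<close>

lemma poly_nc_poly_of_nat:
  assumes "n \<le> K"
  shows "poly (nc_poly n) (of_nat N :: 'a::field_char_0)
    = (\<Sum>i\<le>K. of_nat (nc_surj i n) * of_nat (N choose i))"
  using assms
proof (induction N arbitrary: n K)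
  case 0
  have "(\<Sum>i\<le>K. of_nat (nc_surj i n) * of_nat (0 choose i) :: 'a) = of_nat (nc_surj 0 n)"
    by (simp add: sum.atMost_shift)
  then show ?case by (simp add: poly_nc_poly_at_0)
next
  case (Suc N)
  let ?c = "\<lambda>m. of_nat (Suc m choose (n - m)) :: 'a"
  have IH: "poly (nc_poly m) (of_nat N :: 'a) = (\<Sum>i\<le>K. of_nat (nc_surj i m) * of_nat (N choose i))"
    if "m \<le> n" for m using Suc.IH[of m K] Suc.prems that by simp
  have low: "(\<Sum>m<n. poly (nc_poly m) (of_nat N) * ?c m)
      = (\<Sum>i\<le>K. of_nat (nc_surj (Suc i) n) * of_nat (N choose i))"
  proof -
    have "(\<Sum>m<n. poly (nc_poly m) (of_nat N) * ?c m)
        = (\<Sum>m<n. \<Sum>i\<le>K. of_nat (nc_surj i m) * of_nat (N choose i) * ?c m)"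
      by (simp add: IH sum_distrib_right)
    also have "\<dots> = (\<Sum>i\<le>K. \<Sum>m<n. of_nat (nc_surj i m) * of_nat (N choose i) * ?c m)"
      by (rule sum.swap)
    also have "\<dots> = (\<Sum>i\<le>K. of_nat (nc_surj (Suc i) n) * of_nat (N choose i))"
      by (simp add: sum_distrib_left mult_ac del: binomial_Suc_Suc)
    finally show ?thesis .
  qed
  have shift: "(\<Sum>i\<le>K. of_nat (nc_surj (Suc i) n) * of_nat (N choose i) :: 'a)
      = (\<Sum>i<K. of_nat (nc_surj (Suc i) n) * of_nat (N choose i))"
    unfolding lessThan_Suc_atMost[symmetric] sum.lessThan_Suc
    using nc_surj_eq_0[of n "Suc K"] Suc.prems by (simp del: nc_surj.simps)
  have "poly (nc_poly n) (of_nat (Suc N) :: 'a)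
      = (\<Sum>m<n. poly (nc_poly m) (of_nat N) * ?c m) + poly (nc_poly n) (of_nat N)"
    unfolding poly_nc_poly_of_nat_Suc lessThan_Suc_atMost[symmetric] sum.lessThan_Suc by simp
  also have "\<dots> = (\<Sum>i<K. of_nat (nc_surj (Suc i) n) * of_nat (N choose i))
      + (\<Sum>i\<le>K. of_nat (nc_surj i n) * of_nat (N choose i))"
    by (simp only: low shift IH[OF order_refl])
  also have "\<dots> = (\<Sum>i\<le>K. of_nat (nc_surj i n) * of_nat (Suc N choose i))"
    by (simp add: sum.atMost_shift sum.distrib[symmetric] algebra_simps del: nc_surj.simps)
  finally show ?case .
qed

lemma hilbert_expansion_nc_poly:
  assumes "n \<ge> 1"
  shows "hilbert_expansion (\<lambda>i. of_nat (nc_surj i n)) (nc_poly n :: 'a::field_char_0 poly)"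
proof -
  let ?q = "\<Sum>i\<in>{1..n}. smult (of_nat (nc_surj i n)) (hilbert_poly i) :: 'a poly"
  have "poly (nc_poly n) (of_nat N) = poly ?q (of_nat N)" for N
  proof -
    have "poly (nc_poly n) (of_nat N) = (\<Sum>i\<le>n. of_nat (nc_surj i n) * (of_nat (N choose i) :: 'a))"
      by (rule poly_nc_poly_of_nat) simp
    also have "\<dots> = (\<Sum>i\<in>{1..n}. of_nat (nc_surj i n) * of_nat (N choose i))"
      by (rule sum.mono_neutral_right) (use assms in \<open>auto simp: not_le less_Suc_eq\<close>)
    finally show ?thesis
      by (simp add: poly_sum poly_hilbert_poly binomial_gbinomial)
  qed
  then have "range (of_nat :: nat \<Rightarrow> 'a) \<subseteq> {x. poly (nc_poly n - ?q) x = 0}" by auto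
  moreover have "infinite (range (of_nat :: nat \<Rightarrow> 'a))"
    by (simp add: range_inj_infinite inj_of_nat)
  ultimately have "infinite {x. poly (nc_poly n - ?q) x = 0}" using finite_subset by blast
  then have "nc_poly n = ?q"
    using poly_roots_finite[of "nc_poly n - ?q"] by auto
  moreover have "i \<in> {1..n}" if "1 \<le> i" "of_nat (nc_surj i n) \<noteq> (0::'a)" for i
    using that nc_surj_eq_0[of n i] by (auto simp: not_less[symmetric])
  ultimately show ?thesis
    by (subst hilbert_expansion_superset[of "{1..n}"]) auto
qed

section \<open>The first three diagonals\<close>

lemma nc_surj_Suc_diagonal:
  "nc_surj (Suc i) (Suc i + d) = (\<Sum>e\<le>d. nc_surj i (i + e) * (Suc (i + e) choose (Suc d - e)))"
proof -
  have "nc_surj (Suc i) (Suc i + d)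
      = (\<Sum>m\<in>{i..i + d}. nc_surj i m * (Suc m choose (Suc i + d - m)))"
    unfolding nc_surj.simps
    by (rule sum.mono_neutral_right) (auto simp: nc_surj_eq_0)
  also have "\<dots> = (\<Sum>e\<le>d. nc_surj i (i + e) * (Suc (i + e) choose (Suc d - e)))"
    by (rule sum.reindex_bij_witness[of _ "\<lambda>e. i + e" "\<lambda>m. m - i"]) (auto simp: add.commute)
  finally show ?thesis .
qed

lemma nc_surj_diag_0: "nc_surj n n = fact n"
proof (induction n)
  case (Suc n)
  then show ?case using nc_surj_Suc_diagonal[of n 0] by (simp del: nc_surj.simps(2))
qed simp

lemma of_nat_choose_2: "of_nat (Suc n choose 2) = (of_nat n + 1) * of_nat n / (2::'a::field_char_0)"
  by (simp add: binomial_gbinomial gbinomial_prod_rev numeral_2_eq_2) (simp add: field_simps)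

lemma of_nat_choose_3:
  "of_nat (Suc n choose 3) = (of_nat n + 1) * of_nat n * (of_nat n - 1) / (6::'a::field_char_0)"
  by (simp add: binomial_gbinomial gbinomial_prod_rev numeral_3_eq_3) (simp add: field_simps)

lemma of_nat_add_neq_0: "k > 0 \<Longrightarrow> of_nat (k + n) \<noteq> (0::'a::field_char_0)"
  by (simp only: of_nat_eq_0_iff)

lemma nc_surj_diag_1:
  "of_nat (nc_surj n (n + 1))
    = fact (n + 1) * ((of_nat (n + 1) + 1) / 2 - trunc_mzv (n + 1) [1] :: 'a::field_char_0)"
proof (induction n)
  case 0
  show ?case by (simp add: trunc_mzv_1_Suc trunc_mzv_0)
next
  case (Suc n)
  define x :: 'a where "x = of_nat n"
  define h :: 'a where "h = trunc_mzv (n + 1) [1]"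
  define f :: 'a where "f = fact n"
  have h2: "trunc_mzv (n + 2) [1] = h + 1 / (2 + x)"
    using trunc_mzv_1_Suc[of "n + 1", where 'a='a] by (simp add: h_def x_def add_ac)
  have f1: "fact (n + 1) = (1 + x) * f" and f2: "fact (n + 2) = (2 + x) * (1 + x) * f"
    by (simp_all add: f_def x_def numeral_2_eq_2)
  have nz: "1 + x \<noteq> 0" "2 + x \<noteq> 0"
    using of_nat_add_neq_0[of 1 n] of_nat_add_neq_0[of 2 n] by (simp_all add: x_def add.commute)
  \<comment> \<open>the denominators below, in the expanded form that the simplifier gives them\<close>
  have nz2: "4 + x * 2 \<noteq> 0"
    using of_nat_add_neq_0[of 4 "n * 2"] by (simp add: x_def)
  have "of_nat (nc_surj (Suc n) (Suc n + 1))
      = f * (of_nat (Suc n choose 2) :: 'a) + of_nat (nc_surj n (n + 1)) * (x + 2)"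
    using nc_surj_Suc_diagonal[of n 1]
    by (simp add: nc_surj_diag_0 x_def f_def numeral_2_eq_2 algebra_simps
        del: nc_surj.simps(2) binomial_Suc_Suc)
  also have "\<dots> = f * ((x + 1) * x / 2) + (1 + x) * f * ((x + 2) / 2 - h) * (x + 2)"
    unfolding Suc.IH of_nat_choose_2 f1 by (simp add: x_def h_def f_def add_ac)
  also have "\<dots> = (2 + x) * (1 + x) * f * ((x + 3) / 2 - (h + 1 / (2 + x)))"
    using nz nz2 by (simp add: divide_simps add_ac) (simp add: algebra_simps)
  also have "\<dots> = fact (n + 2) * ((of_nat (n + 2) + 1) / 2 - trunc_mzv (n + 2) [1])"
    unfolding f2 h2 by (simp add: x_def)
  finally show ?case by (simp add: numeral_2_eq_2)
qed

lemma nc_surj_diag_2: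
  "of_nat (nc_surj n (n + 2))
    = fact (n + 2) * (trunc_mzv (n + 2) [1, 1] - of_nat (n + 2) / 2 * trunc_mzv (n + 2) [1]
        + (3 * of_nat (n + 2) - 2) * ((of_nat (n + 2))^2 + of_nat (n + 2) + 6)
          / (24 * of_nat (n + 2)) :: 'a::field_char_0)"
proof (induction n)
  case 0
  show ?case
    by (simp add: trunc_mzv_1_Suc trunc_mzv_11_Suc trunc_mzv_0 numeral_2_eq_2)
next
  case (Suc n)
  define x :: 'a where "x = of_nat n"
  define h :: 'a where "h = trunc_mzv (n + 1) [1]"
  define z :: 'a where "z = trunc_mzv (n + 2) [1, 1]"
  define f :: 'a where "f = fact n"
  have nz: "1 + x \<noteq> 0" "2 + x \<noteq> 0" "3 + x \<noteq> 0"
    using of_nat_add_neq_0[of 1 n] of_nat_add_neq_0[of 2 n] of_nat_add_neq_0[of 3 n]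
    by (simp_all add: x_def add.commute)
  \<comment> \<open>the denominators below, in the expanded form that the simplifier gives them\<close>
  have nz2: "4 + x * 2 \<noteq> 0" "48 + x * 24 \<noteq> 0" "72 + x * 24 \<noteq> 0"
    using of_nat_add_neq_0[of 4 "n * 2"] of_nat_add_neq_0[of 48 "n * 24"]
      of_nat_add_neq_0[of 72 "n * 24"] by (simp_all add: x_def)
  have h2: "trunc_mzv (n + 2) [1] = h + 1 / (2 + x)"
    using trunc_mzv_1_Suc[of "n + 1", where 'a='a] by (simp add: h_def x_def add_ac)
  have h3: "trunc_mzv (n + 3) [1] = h + 1 / (2 + x) + 1 / (3 + x)"
    using trunc_mzv_1_Suc[of "n + 2", where 'a='a] h2 by (simp add: x_def add_ac numeral_3_eq_3)
  have z3: "trunc_mzv (n + 3) [1, 1] = z + (h + 1 / (2 + x)) / (3 + x)"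
    using trunc_mzv_11_Suc[of "n + 2", where 'a='a] h2 by (simp add: z_def x_def add_ac numeral_3_eq_3)
  have f1: "fact (n + 1) = (1 + x) * f" and f2: "fact (n + 2) = (2 + x) * (1 + x) * f"
    and f3: "fact (n + 3) = (3 + x) * (2 + x) * (1 + x) * f"
    by (simp_all add: f_def x_def numeral_2_eq_2 numeral_3_eq_3)
  have "of_nat (nc_surj (Suc n) (Suc n + 2))
      = f * (of_nat (Suc n choose 3) :: 'a)
        + of_nat (nc_surj n (n + 1)) * of_nat (Suc (n + 1) choose 2)
        + of_nat (nc_surj n (n + 2)) * (x + 3)"
    using nc_surj_Suc_diagonal[of n 2]
    by (simp add: nc_surj_diag_0 x_def f_def numeral_2_eq_2 numeral_3_eq_3 algebra_simps
        del: nc_surj.simps(2) binomial_Suc_Suc)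
  also have "\<dots> = f * ((x + 1) * x * (x - 1) / 6)
        + (1 + x) * f * ((x + 2) / 2 - h) * ((x + 2) * (x + 1) / 2)
        + (2 + x) * (1 + x) * f * (z - (x + 2) / 2 * (h + 1 / (2 + x))
          + (3 * (x + 2) - 2) * ((x + 2)^2 + (x + 2) + 6) / (24 * (x + 2))) * (x + 3)"
    unfolding Suc.IH nc_surj_diag_1 of_nat_choose_2 of_nat_choose_3 f1 f2 h2
    by (simp add: x_def h_def z_def add_ac)
  also have "\<dots> = (3 + x) * (2 + x) * (1 + x) * f * (z + (h + 1 / (2 + x)) / (3 + x)
      - (x + 3) / 2 * (h + 1 / (2 + x) + 1 / (3 + x))
      + (3 * (x + 3) - 2) * ((x + 3)^2 + (x + 3) + 6) / (24 * (x + 3)))"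
    using nz nz2 by (simp add: divide_simps add_ac) (simp add: algebra_simps power2_eq_square)
  also have "\<dots> = fact (n + 3) * (trunc_mzv (n + 3) [1, 1]
      - of_nat (n + 3) / 2 * trunc_mzv (n + 3) [1]
      + (3 * of_nat (n + 3) - 2) * ((of_nat (n + 3))^2 + of_nat (n + 3) + 6)
          / (24 * of_nat (n + 3)))"
    unfolding f3 h3 z3 by (simp add: x_def)
  finally show ?case by (simp add: numeral_2_eq_2 numeral_3_eq_3)
qed

theorem corollary3p10:
  fixes a :: "nat \<Rightarrow> nat \<Rightarrow> 'a::field_char_0"
  assumes expansion: "\<And>n. n \<ge> 1 \<Longrightarrow> hilbert_expansion (\<lambda>i. a i n) (nc_poly n)"
  shows "(\<forall>n\<ge>1. a n n = fact n)
    \<and> (\<forall>n\<ge>2. a (n - 1) n = fact n * ((of_nat n + 1) / 2 - trunc_mzv n [1]))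
    \<and> (\<forall>n\<ge>3. a (n - 2) n = fact n * (trunc_mzv n [1, 1] - of_nat n / 2 * trunc_mzv n [1]
          + (3 * of_nat n - 2) * ((of_nat n)^2 + of_nat n + 6) / (24 * of_nat n)))
    \<and> map (\<lambda>n. a (n - 1) n) [2..<11] = [0, 1, 10, 86, 756, 7092, 71856, 787824, 9329760]"
proof -
  have a: "a i n = of_nat (nc_surj i n)" if "1 \<le> i" "1 \<le> n" for i n
    using hilbert_expansion_unique[OF expansion hilbert_expansion_nc_poly] that by blast
  have d0: "a n n = fact n" if "n \<ge> 1" for n
    using a[of n n] that by (simp add: nc_surj_diag_0)
  have d1: "a (n - 1) n = fact n * ((of_nat n + 1) / 2 - trunc_mzv n [1])" if "n \<ge> 2" for n
    using a[of "n - 1" n] nc_surj_diag_1[of "n - 1", where 'a='a] that by simp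
  have d2: "a (n - 2) n = fact n * (trunc_mzv n [1, 1] - of_nat n / 2 * trunc_mzv n [1]
          + (3 * of_nat n - 2) * ((of_nat n)^2 + of_nat n + 6) / (24 * of_nat n))" if "n \<ge> 3" for n
    using a[of "n - 2" n] nc_surj_diag_2[of "n - 2", where 'a='a] that
    by (simp only: le_add_diff_inverse2)
  have "map (\<lambda>n. a (n - 1) n) [2..<11]
      = map (\<lambda>n. fact n * ((of_nat n + 1) / 2 - trunc_mzv n [1])) [2..<11]"
    by (rule map_cong[OF refl], rule d1) auto
  also have "\<dots> = [0, 1, 10, 86, 756, 7092, 71856, 787824, 9329760]"
    by (simp add: fact_numeral trunc_mzv_1_numeral trunc_mzv_1_Suc trunc_mzv_0)
  finally show ?thesis
    using d0 d1 d2 by blast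
qed

end
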